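(* There exist a measurable space $(\Omega,\mathcal{F})$, a family $\{\mathbb{P}_\gamma\}_{\gamma\in\Gamma}$ of probability measures on $(\Omega,\mathcal{F})$, and two sub-$\sigma$-fields $\mathcal{G}_1,\mathcal{G}_2\subset\mathcal{F}$ such that $\mathcal{G}_1$ and $\mathcal{G}_2$ are both sufficient subfields of $\mathcal{F}$ (with respect to $\{\mathbb{P}_\gamma\}_{\gamma\in\Gamma}$), but $\sigma(\mathcal{G}_1\cup\mathcal{G}_2)$ is not a sufficient subfield of $\mathcal{F}$.
   Context: Let $(\Omega,\mathcal{F})$ be a measurable space and $\{\mathbb{P}_\gamma\}_{\gamma\in\Gamma}$ a collection of probability measures on it; $\mathbb{E}_\gamma$ denotes expectation with respect to $\mathbb{P}_\gamma$, and $\mathbb{I}_G$ the indicator function of $G$. A subfield of $\mathcal{F}$ means a sub-$\sigma$-field of $\mathcal{F}$. A $\sigma$-field $\mathcal{G}\subset\mathcal{F}$ is called a sufficient subfield if for each bounded $\mathcal{F}$-measurable function $f$ there is a $\mathcal{G}$-measurable function $g$ such that $\mathbb{E}_\gamma[f\,\mathbb{I}_G]=\mathbb{E}_\gamma[g\,\mathbb{I}_G]$ for all $\gamma\in\Gamma$ and all $G\in\mathcal{G}$; in other words, a single $g$ satisfies $g=\mathbb{E}_\gamma[f\mid\mathcal{G}]$ ($\mathbb{P}_\gamma$-almost surely) for all $\gamma\in\Gamma$. $\sigma(\mathcal{A})$ denotes the $\sigma$-field generated by $\mathcal{A}$. *)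

theory Defs
  imports "HOL-Probability.Probability"
begin

text \<open>
  A \<open>\<sigma>\<close>-field is represented by a value of type \<open>'a measure\<close>, of which only the space and the
  measurable sets are used: this applies to \<open>F\<close> and \<open>G\<close>, but not to the probability measures
  \<open>P \<gamma>\<close>, which are meant to satisfy \<open>sets (P \<gamma>) = sets F\<close>.

  The Bochner integral of a non-integrable function is \<open>0\<close> by convention, so the existence of the
  expectations \<open>E\<^sub>\<gamma>[g I\<^sub>A]\<close> has to be required explicitly; as \<open>space G \<in> sets G\<close> this amounts to
  \<open>P \<gamma>\<close>-integrability of \<open>g\<close>.  For the bounded function \<open>f\<close> integrability is automatic.
\<close>

definition sufficient_subfield ::
  "'a measure \<Rightarrow> 'i set \<Rightarrow> ('i \<Rightarrow> 'a measure) \<Rightarrow> 'a measure \<Rightarrow> bool" where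
  "sufficient_subfield F \<Gamma> P G \<longleftrightarrow>
     subalgebra F G \<and>
     (\<forall>f :: 'a \<Rightarrow> real. f \<in> borel_measurable F \<longrightarrow> (\<exists>B. \<forall>\<omega>\<in>space F. \<bar>f \<omega>\<bar> \<le> B) \<longrightarrow>
       (\<exists>g :: 'a \<Rightarrow> real. g \<in> borel_measurable G \<and>
         (\<forall>\<gamma>\<in>\<Gamma>. integrable (P \<gamma>) g \<and>
           (\<forall>A\<in>sets G. (\<integral>\<omega>. f \<omega> * indicator A \<omega> \<partial>P \<gamma>) = (\<integral>\<omega>. g \<omega> * indicator A \<omega> \<partial>P \<gamma>)))))"

end

theory Submission
  imports Defs
begin

text \<open>
  If an involution \<open>\<phi>\<close> is measurable and preserves every \<open>P \<gamma>\<close>, then the \<open>\<sigma>\<close>-field of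
  \<open>\<phi>\<close>-invariant measurable sets is sufficient, because \<open>(f + f \<circ> \<phi>) / 2\<close> is a version of the
  conditional expectation of \<open>f\<close> that serves all \<open>\<gamma>\<close> at once (\<open>sufficient_invariant_field\<close>).

  Now take two such involutions \<open>\<phi>\<close>, \<open>\<psi>\<close> of the real line, each exchanging the two open half lines,
  which commute, agree at every \<open>\<omega>\<close> with \<open>\<bar>\<omega>\<bar> \<ge> 1\<close>, and differ at all but three points of
  \<open>(-1, 1)\<close>.  The measure \<open>P \<gamma>\<close> is uniform on the orbit of \<open>\<gamma>\<close> under the group that they generate.
  The \<open>\<sigma>\<close>-field \<open>F\<close> consists of the sets that, on each open half line, are countable or
  co-countable; every bijection that exchanges the half lines respects this condition, so \<open>\<phi>\<close> and
  \<open>\<psi>\<close> are measurable.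

  The join of the two invariant \<open>\<sigma>\<close>-fields cannot separate \<open>\<omega>\<close> from \<open>\<phi> \<omega> = \<psi> \<omega>\<close> if
  \<open>\<bar>\<omega>\<bar> \<ge> 1\<close> (\<open>join_symmetric\<close>), but contains \<open>{\<omega>} = {\<omega>, \<phi> \<omega>} \<inter> {\<omega>, \<psi> \<omega>}\<close> if
  \<open>0 < \<omega> < 1/2\<close> (\<open>join_singleton\<close>).  So a common conditional expectation of the indicator of \<open>(0, \<infinity>)\<close> given the
  join would have to be \<open>1/2\<close> on \<open>[1, \<infinity>)\<close> and \<open>1\<close> on \<open>(0, 1/2)\<close>.  Its level set at
  \<open>1/2\<close> would then be neither countable nor co-countable in \<open>(0, \<infinity>)\<close>, so it is not even
  \<open>F\<close>-measurable.
\<close>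

section \<open>The field of sets invariant under an involution\<close>

text \<open>The \<open>\<sigma>\<close>-field of the measurable sets that equal their preimage under \<open>\<phi>\<close>.  That this family
  is a \<open>\<sigma>\<close>-field, and hence that \<open>sigma\<close> adds nothing to it, is \<open>sets_invariant_field\<close>.\<close>

definition invariant_field :: "'a measure \<Rightarrow> ('a \<Rightarrow> 'a) \<Rightarrow> 'a measure" where
  "invariant_field F \<phi> = sigma (space F) {A \<in> sets F. \<phi> -` A \<inter> space F = A}"

lemma space_invariant_field [simp]: "space (invariant_field F \<phi>) = space F"
  unfolding invariant_field_def by (rule space_measure_of) (auto dest: sets.sets_into_space)

lemma sets_invariant_field:
  assumes "\<phi> \<in> measurable F F"
  shows "sets (invariant_field F \<phi>) = {A \<in> sets F. \<phi> -` A \<inter> space F = A}"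
proof -
  have "sigma_algebra (space F) {A \<in> sets F. \<phi> -` A \<inter> space F = A}"
    unfolding sigma_algebra_iff2
    using measurable_space[OF assms] by (auto dest: sets.sets_into_space; blast)
  then show ?thesis
    unfolding invariant_field_def by (simp add: sigma_algebra.sets_measure_of_eq)
qed

lemma subalgebra_invariant_field:
  "\<phi> \<in> measurable F F \<Longrightarrow> subalgebra F (invariant_field F \<phi>)"
  by (auto simp: subalgebra_def sets_invariant_field)

text \<open>As \<open>\<phi>\<close> preserves both \<open>P \<gamma>\<close> and the invariant set \<open>A\<close>, the functions \<open>f\<close> and \<open>f \<circ> \<phi>\<close> have
  the same integral over \<open>A\<close>, hence so has their mean, which is an invariant function.\<close>

lemma sufficient_invariant_field:
  assumes \<phi>: "\<phi> \<in> measurable F F"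
    and involution: "\<And>\<omega>. \<omega> \<in> space F \<Longrightarrow> \<phi> (\<phi> \<omega>) = \<omega>"
    and prob: "\<And>\<gamma>. \<gamma> \<in> \<Gamma> \<Longrightarrow> prob_space (P \<gamma>)"
    and sets_P: "\<And>\<gamma>. \<gamma> \<in> \<Gamma> \<Longrightarrow> sets (P \<gamma>) = sets F"
    and preserved: "\<And>\<gamma>. \<gamma> \<in> \<Gamma> \<Longrightarrow> distr (P \<gamma>) F \<phi> = P \<gamma>"
  shows "sufficient_subfield F \<Gamma> P (invariant_field F \<phi>)"
  unfolding sufficient_subfield_def
proof (intro conjI allI impI)
  show "subalgebra F (invariant_field F \<phi>)"
    using \<phi> by (rule subalgebra_invariant_field)
next
  fix f :: "'a \<Rightarrow> real"
  assume f: "f \<in> borel_measurable F" and "\<exists>B. \<forall>\<omega>\<in>space F. \<bar>f \<omega>\<bar> \<le> B"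
  then obtain B where B: "\<And>\<omega>. \<omega> \<in> space F \<Longrightarrow> \<bar>f \<omega>\<bar> \<le> B" by blast
  define g where "g \<omega> = (f \<omega> + f (\<phi> \<omega>)) / 2" for \<omega>
  have f\<phi>: "(\<lambda>\<omega>. f (\<phi> \<omega>)) \<in> borel_measurable F"
    using \<phi> f by measurable
  have gF: "g \<in> borel_measurable F"
    unfolding g_def using f f\<phi> by measurable
  have g\<phi>: "g (\<phi> \<omega>) = g \<omega>" if "\<omega> \<in> space F" for \<omega>
    using involution[OF that] by (simp add: g_def add.commute)
  have gG: "g \<in> borel_measurable (invariant_field F \<phi>)"
  proof (rule measurableI)
    fix C :: "real set" assume "C \<in> sets borel"
    then have "g -` C \<inter> space F \<in> sets F" using gF by (rule measurable_sets[rotated])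
    then show "g -` C \<inter> space (invariant_field F \<phi>) \<in> sets (invariant_field F \<phi>)"
      using g\<phi> measurable_space[OF \<phi>] by (auto simp: sets_invariant_field[OF \<phi>])
  qed simp
  show "\<exists>g. g \<in> borel_measurable (invariant_field F \<phi>) \<and>
         (\<forall>\<gamma>\<in>\<Gamma>. integrable (P \<gamma>) g \<and>
           (\<forall>A\<in>sets (invariant_field F \<phi>).
             (\<integral>\<omega>. f \<omega> * indicator A \<omega> \<partial>P \<gamma>) = (\<integral>\<omega>. g \<omega> * indicator A \<omega> \<partial>P \<gamma>)))"
  proof (intro exI[of _ g] conjI ballI gG)
    fix \<gamma> assume \<gamma>: "\<gamma> \<in> \<Gamma>"
    interpret prob_space "P \<gamma>" using prob[OF \<gamma>] .
    have spP: "space (P \<gamma>) = space F" by (rule sets_eq_imp_space_eq[OF sets_P[OF \<gamma>]])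
    have mP: "measurable (P \<gamma>) N = measurable F N" for N :: "'c measure"
      by (rule measurable_cong_sets[OF sets_P[OF \<gamma>] refl])
    have bounded: "integrable (P \<gamma>) h"
      if "h \<in> borel_measurable F" "\<And>\<omega>. \<omega> \<in> space F \<Longrightarrow> \<bar>h \<omega>\<bar> \<le> B" for h :: "'a \<Rightarrow> real"
      using that by (intro integrable_const_bound[of _ B]) (auto simp: spP mP)
    have f_int: "integrable (P \<gamma>) f" using f B by (rule bounded)
    have f\<phi>_int: "integrable (P \<gamma>) (\<lambda>\<omega>. f (\<phi> \<omega>))"
      using f\<phi> B measurable_space[OF \<phi>] by (auto intro: bounded)
    show "integrable (P \<gamma>) g"
      unfolding g_def using f_int f\<phi>_int by simp
    fix A assume "A \<in> sets (invariant_field F \<phi>)"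
    then have A: "A \<in> sets F" "\<phi> -` A \<inter> space F = A"
      by (auto simp: sets_invariant_field[OF \<phi>])
    have AP: "A \<in> sets (P \<gamma>)" using A(1) sets_P[OF \<gamma>] by simp
    have "(\<integral>\<omega>. f \<omega> * indicator A \<omega> \<partial>P \<gamma>) = (\<integral>\<omega>. f \<omega> * indicator A \<omega> \<partial>distr (P \<gamma>) F \<phi>)"
      by (simp add: preserved[OF \<gamma>])
    also have "\<dots> = (\<integral>\<omega>. f (\<phi> \<omega>) * indicator A (\<phi> \<omega>) \<partial>P \<gamma>)"
      using \<phi> f A(1) by (intro integral_distr) (auto simp: mP)
    also have "\<dots> = (\<integral>\<omega>. f (\<phi> \<omega>) * indicator A \<omega> \<partial>P \<gamma>)"
      using A(2) by (intro Bochner_Integration.integral_cong) (auto simp: spP indicator_def)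
    finally have swap: "(\<integral>\<omega>. f (\<phi> \<omega>) * indicator A \<omega> \<partial>P \<gamma>) = (\<integral>\<omega>. f \<omega> * indicator A \<omega> \<partial>P \<gamma>)" ..
    have "(\<integral>\<omega>. g \<omega> * indicator A \<omega> \<partial>P \<gamma>)
        = (\<integral>\<omega>. (f \<omega> * indicator A \<omega> + f (\<phi> \<omega>) * indicator A \<omega>) / 2 \<partial>P \<gamma>)"
      by (simp add: g_def algebra_simps add_divide_distrib)
    also have "\<dots> = ((\<integral>\<omega>. f \<omega> * indicator A \<omega> \<partial>P \<gamma>) + (\<integral>\<omega>. f (\<phi> \<omega>) * indicator A \<omega> \<partial>P \<gamma>)) / 2"
      using integrable_real_mult_indicator[OF AP f_int] integrable_real_mult_indicator[OF AP f\<phi>_int]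
      by simp
    finally show "(\<integral>\<omega>. f \<omega> * indicator A \<omega> \<partial>P \<gamma>) = (\<integral>\<omega>. g \<omega> * indicator A \<omega> \<partial>P \<gamma>)"
      using swap by simp
  qed
qed

section \<open>Sets countable or co-countable on each half line\<close>

text \<open>The set \<open>A\<close> is countable or co-countable within \<open>T\<close>, so that its indicator is constant on \<open>T\<close>
  up to countably many points.\<close>

definition ess_constant_on :: "'a set \<Rightarrow> 'a set \<Rightarrow> bool" where
  "ess_constant_on T A \<longleftrightarrow> countable (A \<inter> T) \<or> countable (T - A)"

lemma ess_constant_on_Union:
  assumes "\<And>i::nat. ess_constant_on T (A i)"
  shows "ess_constant_on T (\<Union>i. A i)"
proof (cases "\<exists>i. countable (T - A i)")
  case True
  then obtain i where "countable (T - A i)" ..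
  then have "countable (T - (\<Union>i. A i))" by (rule countable_subset[rotated]) auto
  then show ?thesis by (simp add: ess_constant_on_def)
next
  case False
  then have "countable (\<Union>i. A i \<inter> T)"
    using assms by (intro countable_UN) (auto simp: ess_constant_on_def)
  then show ?thesis by (simp add: ess_constant_on_def)
qed

lemma ess_constant_on_vimage:
  assumes "inj \<phi>" "\<phi> ` T \<subseteq> T'" "ess_constant_on T' A"
  shows "ess_constant_on T (\<phi> -` A)"
proof -
  have "countable {\<omega> \<in> T. \<phi> \<omega> \<in> C}" if "countable C" for C
  proof -
    have "inj_on \<phi> {\<omega> \<in> T. \<phi> \<omega> \<in> C}"
      using assms(1) by (rule inj_on_subset) simp
    moreover have "countable (\<phi> ` {\<omega> \<in> T. \<phi> \<omega> \<in> C})"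
      using that by (rule countable_subset[rotated]) auto
    ultimately show ?thesis by (simp add: countable_image_inj_eq)
  qed
  moreover have "\<phi> -` A \<inter> T = {\<omega> \<in> T. \<phi> \<omega> \<in> A \<inter> T'}" "T - \<phi> -` A = {\<omega> \<in> T. \<phi> \<omega> \<in> T' - A}"
    using assms(2) by auto
  ultimately show ?thesis
    using assms(3) unfolding ess_constant_on_def by metis
qed

text \<open>The \<open>\<sigma>\<close>-field \<open>F\<close> of the construction.  The origin belongs to neither half line, so its
  membership in a set is unrestricted.\<close>

definition half_line_field :: "real measure" where
  "half_line_field = sigma UNIV {A. ess_constant_on {0<..} A \<and> ess_constant_on {..<0} A}"

lemma space_half_line_field [simp]: "space half_line_field = UNIV"
  by (simp add: half_line_field_def)

lemma sets_half_line_field: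
  "sets half_line_field = {A. ess_constant_on {0<..} A \<and> ess_constant_on {..<0} A}"
proof -
  have "sigma_algebra UNIV {A. ess_constant_on {0<..} A \<and> ess_constant_on {..<(0::real)} A}"
    unfolding sigma_algebra_iff2
    by (auto intro!: ess_constant_on_Union)
       (auto simp: ess_constant_on_def Diff_eq Int_commute)
  then show ?thesis
    unfolding half_line_field_def by (rule sigma_algebra.sets_measure_of_eq)
qed

lemma countable_in_half_line_field: "countable A \<Longrightarrow> A \<in> sets half_line_field"
  by (auto simp: sets_half_line_field ess_constant_on_def)

lemma measurable_half_line_field:
  assumes "inj \<phi>" "\<phi> ` {0<..} \<subseteq> {..<0}" "\<phi> ` {..<0} \<subseteq> {0<..}"
  shows "\<phi> \<in> measurable half_line_field half_line_field"
  using ess_constant_on_vimage[OF assms(1,2)] ess_constant_on_vimage[OF assms(1,3)]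
  by (intro measurableI) (auto simp: sets_half_line_field)

section \<open>The two involutions and their orbits\<close>

text \<open>The second involution; the first one is negation.  The two differ exactly on
  \<open>(-1, 1)\<close> without the three points \<open>0\<close> and \<open>\<plusminus>1/2\<close>.\<close>

definition shift_flip :: "real \<Rightarrow> real" where
  "shift_flip \<omega> = (if 0 < \<omega> \<and> \<omega> < 1 then \<omega> - 1 else if -1 < \<omega> \<and> \<omega> < 0 then \<omega> + 1 else - \<omega>)"

lemma shift_flip_shift_flip [simp]: "shift_flip (shift_flip \<omega>) = \<omega>"
  by (auto simp: shift_flip_def)

lemma shift_flip_minus [simp]: "shift_flip (- \<omega>) = - shift_flip \<omega>"
  by (auto simp: shift_flip_def)

lemma measurable_uminus_half_line:
  "uminus \<in> measurable half_line_field half_line_field"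
  by (rule measurable_half_line_field) auto

lemma measurable_shift_flip_half_line:
  "shift_flip \<in> measurable half_line_field half_line_field"
  by (rule measurable_half_line_field, rule injI, metis shift_flip_shift_flip)
     (auto simp: shift_flip_def)

text \<open>The orbit of a point under the group generated by negation and \<open>shift_flip\<close>.  It has no
  further elements, as the two involutions commute.\<close>

definition orbit :: "real \<Rightarrow> real set" where
  "orbit \<gamma> = {\<gamma>, - \<gamma>, shift_flip \<gamma>, - shift_flip \<gamma>}"

lemma finite_orbit [simp]: "finite (orbit \<gamma>)" and orbit_nonempty [simp]: "orbit \<gamma> \<noteq> {}"
  by (simp_all add: orbit_def)

text \<open>The uniform distribution on the orbit.  Every set is measurable for a \<open>pmf\<close>; the image under
  the identity restricts the distribution to \<open>half_line_field\<close>.\<close>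

definition orbit_measure :: "real \<Rightarrow> real measure" where
  "orbit_measure \<gamma> = distr (measure_pmf (pmf_of_set (orbit \<gamma>))) half_line_field id"

lemma sets_orbit_measure: "sets (orbit_measure \<gamma>) = sets half_line_field"
  by (simp add: orbit_measure_def)

lemma prob_space_orbit_measure: "prob_space (orbit_measure \<gamma>)"
  unfolding orbit_measure_def
  by (rule prob_space.prob_space_distr[OF measure_pmf.prob_space_axioms]) simp

lemma integral_orbit_measure:
  fixes h :: "real \<Rightarrow> real"
  assumes "h \<in> borel_measurable half_line_field"
  shows "(\<integral>\<omega>. h \<omega> \<partial>orbit_measure \<gamma>) = sum h (orbit \<gamma>) / card (orbit \<gamma>)"
  using assms by (simp add: orbit_measure_def integral_distr integral_pmf_of_set)

lemma distr_orbit_measure: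
  assumes \<phi>: "\<phi> \<in> measurable half_line_field half_line_field"
    and "inj \<phi>" "\<phi> ` orbit \<gamma> = orbit \<gamma>"
  shows "distr (orbit_measure \<gamma>) half_line_field \<phi> = orbit_measure \<gamma>"
proof -
  let ?p = "pmf_of_set (orbit \<gamma>)"
  have "map_pmf \<phi> ?p = ?p"
    using assms(2,3) by (subst map_pmf_of_set_inj) (auto intro: inj_on_subset)
  then have "orbit_measure \<gamma> = distr (measure_pmf (map_pmf \<phi> ?p)) half_line_field id"
    by (simp add: orbit_measure_def)
  also have "\<dots> = distr (measure_pmf ?p) half_line_field \<phi>"
    by (simp add: map_pmf_rep_eq distr_distr)
  also have "\<dots> = distr (orbit_measure \<gamma>) half_line_field \<phi>"
    using \<phi> by (simp add: orbit_measure_def distr_distr)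
  finally show ?thesis ..
qed

lemma sufficient_uminus:
  "sufficient_subfield half_line_field UNIV orbit_measure (invariant_field half_line_field uminus)"
  by (intro sufficient_invariant_field distr_orbit_measure measurable_uminus_half_line
      prob_space_orbit_measure sets_orbit_measure)
     (auto simp: orbit_def)

lemma sufficient_shift_flip:
  "sufficient_subfield half_line_field UNIV orbit_measure (invariant_field half_line_field shift_flip)"
  by (intro sufficient_invariant_field distr_orbit_measure measurable_shift_flip_half_line
      prob_space_orbit_measure sets_orbit_measure, simp, rule injI, metis shift_flip_shift_flip)
     (auto simp: orbit_def)

section \<open>The join of the two invariant fields\<close>

abbreviation join_field :: "real measure" where
  "join_field \<equiv> sigma (space half_line_field)
     (sets (invariant_field half_line_field uminus) \<union> sets (invariant_field half_line_field shift_flip))"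

lemma join_symmetric:
  assumes "A \<in> sets join_field" "1 \<le> \<bar>\<omega>\<bar>"
  shows "- \<omega> \<in> A \<longleftrightarrow> \<omega> \<in> A"
proof -
  have eq: "shift_flip \<omega> = - \<omega>" using assms(2) by (auto simp: shift_flip_def)
  have "A \<in> sigma_sets UNIV (sets (invariant_field half_line_field uminus)
          \<union> sets (invariant_field half_line_field shift_flip))"
    using assms(1) by simp
  then show ?thesis
  proof induction
    case (Basic A)
    then have "uminus -` A = A \<or> shift_flip -` A = A"
      by (auto simp: sets_invariant_field measurable_uminus_half_line measurable_shift_flip_half_line)
    then show ?case using eq by (metis vimage_eq)
  qed auto
qed

lemma join_singleton:
  assumes "0 < \<omega>" "\<omega> < 1/2"
  shows "{\<omega>} \<in> sets join_field"
proof -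
  have "{\<omega>, - \<omega>} \<in> sets (invariant_field half_line_field uminus)"
    by (auto simp: sets_invariant_field measurable_uminus_half_line countable_in_half_line_field)
  moreover have "shift_flip -` {\<omega>, shift_flip \<omega>} = {\<omega>, shift_flip \<omega>}"
    by (auto, metis shift_flip_shift_flip)
  then have "{\<omega>, shift_flip \<omega>} \<in> sets (invariant_field half_line_field shift_flip)"
    by (simp add: sets_invariant_field measurable_shift_flip_half_line countable_in_half_line_field)
  ultimately have "{\<omega>, - \<omega>} \<in> sets join_field" "{\<omega>, shift_flip \<omega>} \<in> sets join_field"
    by (auto simp: sigma_sets.Basic)
  then have "{\<omega>, - \<omega>} \<inter> {\<omega>, shift_flip \<omega>} \<in> sets join_field"
    by (rule sets.Int)
  moreover have "{\<omega>, - \<omega>} \<inter> {\<omega>, shift_flip \<omega>} = {\<omega>}"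
    using assms by (auto simp: shift_flip_def)
  ultimately show ?thesis by (simp only:)
qed

lemma not_sufficient_join:
  "\<not> sufficient_subfield half_line_field UNIV orbit_measure join_field"
proof
  assume suff: "sufficient_subfield half_line_field UNIV orbit_measure join_field"
  then have sub: "sets join_field \<subseteq> sets half_line_field"
    unfolding sufficient_subfield_def subalgebra_def by blast
  define f :: "real \<Rightarrow> real" where "f = indicator {0<..}"
  have "{0<..} \<in> sets half_line_field"
  proof -
    have "{0<..} \<inter> {..<0} = ({} :: real set)" by auto
    then show ?thesis by (simp add: sets_half_line_field ess_constant_on_def)
  qed
  then have f: "f \<in> borel_measurable half_line_field"
    unfolding f_def by measurable
  moreover have "\<exists>B. \<forall>\<omega>\<in>space half_line_field. \<bar>f \<omega>\<bar> \<le> B"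
    by (intro exI[of _ 1]) (auto simp: f_def indicator_def)
  ultimately obtain g :: "real \<Rightarrow> real" where g: "g \<in> borel_measurable join_field"
    and eq: "\<And>\<gamma> A. A \<in> sets join_field \<Longrightarrow>
      (\<integral>\<omega>. f \<omega> * indicator A \<omega> \<partial>orbit_measure \<gamma>) = (\<integral>\<omega>. g \<omega> * indicator A \<omega> \<partial>orbit_measure \<gamma>)"
    using suff unfolding sufficient_subfield_def by blast
  have level: "g -` {c} \<in> sets join_field" for c
    using measurable_sets[OF g, of "{c}"] by simp
  have gF: "g \<in> borel_measurable half_line_field"
    using g sub by (auto simp: measurable_def)
  have sums: "(\<Sum>\<omega>\<in>orbit \<gamma>. f \<omega> * indicator A \<omega>) = (\<Sum>\<omega>\<in>orbit \<gamma>. g \<omega> * indicator A \<omega>)"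
    if A: "A \<in> sets join_field" for A \<gamma>
  proof -
    have "A \<in> sets half_line_field" using A sub by blast
    then have "(\<lambda>\<omega>. f \<omega> * indicator A \<omega>) \<in> borel_measurable half_line_field"
      "(\<lambda>\<omega>. g \<omega> * indicator A \<omega>) \<in> borel_measurable half_line_field"
      using f gF by measurable
    then show ?thesis
      using eq[OF A, of \<gamma>] by (simp add: integral_orbit_measure card_eq_0_iff)
  qed
  have half: "g \<gamma> = 1/2" if "1 \<le> \<gamma>" for \<gamma>
  proof -
    have orb: "orbit \<gamma> = {\<gamma>, - \<gamma>}" using that by (auto simp: orbit_def shift_flip_def)
    have "g (- \<gamma>) = g \<gamma>"
      using join_symmetric[OF level[of "g \<gamma>"], of \<gamma>] that by simp
    moreover have "(\<Sum>\<omega>\<in>{\<gamma>, - \<gamma>}. f \<omega>) = (\<Sum>\<omega>\<in>{\<gamma>, - \<gamma>}. g \<omega>)"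
      using sums[OF sets.top, of \<gamma>] by (simp add: orb)
    ultimately show ?thesis using that by (simp add: f_def)
  qed
  have one: "g \<gamma> = 1" if "0 < \<gamma>" "\<gamma> < 1/2" for \<gamma>
  proof -
    have "(\<Sum>\<omega>\<in>orbit \<gamma>. f \<omega> * indicator {\<gamma>} \<omega>) = (\<Sum>\<omega>\<in>orbit \<gamma>. g \<omega> * indicator {\<gamma>} \<omega>)"
      using that by (intro sums join_singleton)
    moreover have "(\<Sum>\<omega>\<in>orbit \<gamma>. h \<omega> * indicator {\<gamma>} \<omega>) = h \<gamma>" for h :: "real \<Rightarrow> real"
    proof -
      have "(\<Sum>\<omega>\<in>orbit \<gamma>. h \<omega> * indicator {\<gamma>} \<omega>) = (\<Sum>\<omega>\<in>{\<gamma>}. h \<omega> * indicator {\<gamma>} \<omega>)"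
        by (rule sum.mono_neutral_right) (auto simp: orbit_def)
      then show ?thesis by simp
    qed
    ultimately show ?thesis using that by (simp add: f_def)
  qed
  have "g -` {1/2} \<in> sets half_line_field" using level sub by blast
  then consider "countable (g -` {1/2} \<inter> {0<..})" | "countable ({0<..} - g -` {1/2})"
    by (auto simp: sets_half_line_field ess_constant_on_def)
  then show False
  proof cases
    case 1
    moreover have "{1<..<2} \<subseteq> g -` {1/2} \<inter> {0<..}" using half by auto
    ultimately have "countable {1<..<2::real}" by (rule countable_subset[rotated])
    then show False using uncountable_open_interval[of 1 2] by linarith
  next
    case 2
    moreover have "{0<..<1/2} \<subseteq> {0<..} - g -` {1/2}" using one by auto
    ultimately have "countable {0<..<1/2::real}" by (rule countable_subset[rotated])
    then show False using uncountable_open_interval[of 0 "1/2"] by simp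
  qed
qed

theorem mainTheorem1:
  shows "\<exists>(F :: real measure) (\<Gamma> :: real set) (P :: real \<Rightarrow> real measure)
           (G1 :: real measure) (G2 :: real measure).
           (\<forall>\<gamma>\<in>\<Gamma>. prob_space (P \<gamma>) \<and> sets (P \<gamma>) = sets F) \<and>
           subalgebra F G1 \<and> subalgebra F G2 \<and>
           sufficient_subfield F \<Gamma> P G1 \<and> sufficient_subfield F \<Gamma> P G2 \<and>
           \<not> sufficient_subfield F \<Gamma> P (sigma (space F) (sets G1 \<union> sets G2))"
  by (rule exI[of _ half_line_field], rule exI[of _ UNIV], rule exI[of _ orbit_measure],
      rule exI[of _ "invariant_field half_line_field uminus"],
      rule exI[of _ "invariant_field half_line_field shift_flip"])
     (intro conjI ballI prob_space_orbit_measure sets_orbit_measure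
      subalgebra_invariant_field measurable_uminus_half_line measurable_shift_flip_half_line
      sufficient_uminus sufficient_shift_flip not_sufficient_join)

end
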